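(* Let $d \geq 2$ be an integer, let $F = (F_1,\ldots,F_m) : \mathbb{C}^n \to \mathbb{C}^m$ be a polynomial map of degree $\leq d$, and let $\beta, \gamma \in \mathbb{C}^n$. Then the following statements are equivalent. (1) There exist $\lambda_1, \lambda_2, \ldots, \lambda_{d-1} \in \mathbb{C}$ satisfying $\sum_{i\in I} \lambda_i \neq 0$ for all nonempty $I \subseteq \{1,2,\ldots,d-1\}$, such that $$\sum_{i=1}^{d-1} \lambda_i \cdot (\mathcal{J}F)|_{X=\alpha_i} \cdot \gamma \neq 0$$ for all $\alpha_1,\ldots,\alpha_{d-1} \in \{\beta + \mu\gamma \mid \mu \in \mathbb{C}\}$. (2) $F|_{\beta + \mathbb{C}\gamma}$ is linearly rectifiable (in particular injective), i.e. there exists a vector $v \in \mathbb{C}^m$ such that $$\sum_{j=1}^m v_j \cdot \frac{\mathrm{d}}{\mathrm{d}T}\big(F_j(\beta + T\gamma)\big) = 1$$ as an identity in $\mathbb{C}[T]$. (3) For all $s \in \mathbb{N}$, $$\sum_{i=1}^{s} \lambda_i \cdot (\mathcal{J}F)|_{X=\alpha_i} \cdot \gamma \neq 0$$ for all $\lambda_1,\ldots,\lambda_s \in \mathbb{C}$ such that $\lambda_1 + \lambda_2 + \cdots + \lambda_s \neq 0$, and all $\alpha_1,\ldots,\alpha_s \in \{\beta + \mu\gamma \mid \mu \in \mathbb{C}\}$.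
   Context: $\mathcal{J}F$ denotes the Jacobian matrix of $F$ with respect to the coordinates $X=(X_1,\ldots,X_n)$ (an $m\times n$ matrix of polynomials), and $(\mathcal{J}F)|_{X=\alpha}$ is its evaluation at $\alpha \in \mathbb{C}^n$. The vector $\gamma$ is regarded as a column vector. $F|_{\beta+\mathbb{C}\gamma}$ is the restriction of $F$ to $\{\beta+\mu\gamma\mid\mu\in\mathbb{C}\}$, and $T$ is an indeterminate. *)

theory Defs
  imports "HOL-Analysis.Analysis" "HOL-Computational_Algebra.Polynomial" "HOL-Library.Poly_Mapping"
begin

text \<open>
  A polynomial in the indeterminates \<open>X\<^sub>i\<close>, \<open>i :: 'n\<close>, maps each monomial (an exponent vector
  \<open>'n \<Rightarrow>\<^sub>0 nat\<close>) to its coefficient. A polynomial map from \<open>complex ^ 'n\<close> to \<open>complex ^ 'm\<close> is a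
  vector of such polynomials.
\<close>

type_synonym 'n cmpoly = "('n \<Rightarrow>\<^sub>0 nat) \<Rightarrow>\<^sub>0 complex"

type_synonym ('n, 'm) polymap = "'n cmpoly ^ 'm"

definition total_degree :: "('n::finite) cmpoly \<Rightarrow> nat" where
  "total_degree p = Max (insert 0 ((\<lambda>m. \<Sum>i\<in>UNIV. Poly_Mapping.lookup m i) ` Poly_Mapping.keys p))"

definition map_degree :: "('n::finite, 'm::finite) polymap \<Rightarrow> nat" where
  "map_degree F = Max (range (\<lambda>j. total_degree (F $ j)))"

text \<open>
  Substitution \<open>X\<^sub>i := x i\<close> into a commutative ring, where \<open>h\<close> embeds the coefficients.
\<close>

definition subst_mpoly ::
    "(complex \<Rightarrow> 'r) \<Rightarrow> ('n \<Rightarrow> 'r) \<Rightarrow> ('n::finite) cmpoly \<Rightarrow> 'r::comm_ring_1" where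
  "subst_mpoly h x p = (\<Sum>m\<in>Poly_Mapping.keys p. h (Poly_Mapping.lookup p m) * (\<Prod>i\<in>UNIV. x i ^ Poly_Mapping.lookup m i))"

definition eval_mpoly :: "('n::finite) cmpoly \<Rightarrow> complex ^ 'n \<Rightarrow> complex" where
  "eval_mpoly p a = subst_mpoly (\<lambda>c. c) (\<lambda>i. a $ i) p"

definition eval_map :: "('n::finite, 'm::finite) polymap \<Rightarrow> complex ^ 'n \<Rightarrow> complex ^ 'm" where
  "eval_map F a = (\<chi> j. eval_mpoly (F $ j) a)"

text \<open>
  The formal derivative \<open>\<partial>p/\<partial>X\<^sub>i\<close>. If \<open>X\<^sub>i\<close> does not occur in \<open>m\<close>, the truncated exponent
  \<open>m - single i 1\<close> is harmless because the coefficient is zero.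
\<close>

definition partial_deriv :: "'n \<Rightarrow> ('n::finite) cmpoly \<Rightarrow> 'n cmpoly" where
  "partial_deriv i p =
    (\<Sum>m\<in>Poly_Mapping.keys p. Poly_Mapping.single (m - Poly_Mapping.single i 1)
                    (of_nat (Poly_Mapping.lookup m i) * Poly_Mapping.lookup p m))"

definition jacobian_matrix :: "('n::finite, 'm::finite) polymap \<Rightarrow> 'n cmpoly ^ 'n ^ 'm" where
  "jacobian_matrix F = (\<chi> j i. partial_deriv i (F $ j))"

definition eval_matrix ::
    "('n::finite) cmpoly ^ 'k::finite ^ 'm::finite \<Rightarrow> complex ^ 'n \<Rightarrow> complex ^ 'k ^ 'm" where
  "eval_matrix M a = (\<chi> j i. eval_mpoly (M $ j $ i) a)"

definition line :: "complex ^ ('n::finite) \<Rightarrow> complex ^ 'n \<Rightarrow> (complex ^ 'n) set" where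
  "line b g = {b + \<mu> *s g | \<mu>. True}"

text \<open>\<open>p(b + T g)\<close> as a univariate polynomial in \<open>T\<close>.\<close>

definition line_poly ::
    "('n::finite) cmpoly \<Rightarrow> complex ^ 'n \<Rightarrow> complex ^ 'n \<Rightarrow> complex poly" where
  "line_poly p b g = subst_mpoly (\<lambda>c. [:c:]) (\<lambda>i. [:b $ i, g $ i:]) p"

definition linearly_rectifiable_on_line ::
    "('n::finite, 'm::finite) polymap \<Rightarrow> complex ^ 'n \<Rightarrow> complex ^ 'n \<Rightarrow> bool" where
  "linearly_rectifiable_on_line F b g \<longleftrightarrow>
    (\<exists>v :: complex ^ 'm. (\<Sum>j\<in>UNIV. smult (v $ j) (pderiv (line_poly (F $ j) b g))) = 1)"

end

theory Submission
  imports Defs "HOL-Computational_Algebra.Fundamental_Theorem_Algebra"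
begin

text \<open>
  Let \<open>N = d - 1\<close>. Along the line, the chain rule gives
  \<open>JF(\<beta> + T \<gamma>) \<gamma> = c\<^sub>0 + T c\<^sub>1 + \<dots> + T\<^sup>N c\<^sub>N\<close> with vectors \<open>c\<^sub>k \<in> \<complex>\<^sup>m\<close>; this is
  \<open>jacobian_times_direction\<close>. A rectifying vector \<open>v\<close> is a linear functional that is 1 on \<open>c\<^sub>0\<close>
  and 0 on \<open>c\<^sub>1, \<dots>, c\<^sub>N\<close>, so it exists if and only if \<open>c\<^sub>0\<close> is not in the span of the other \<open>c\<^sub>k\<close>.

  Given such a \<open>v\<close>, pairing it with \<open>\<Sum>\<^sub>i \<lambda>\<^sub>i JF(\<alpha>\<^sub>i) \<gamma>\<close> gives \<open>\<Sum>\<^sub>i \<lambda>\<^sub>i\<close>, which yields (3); and \<open>v \<bullet> F\<close> is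
  \<open>T\<close> plus a constant along the line, which yields injectivity. Statement (1) follows from (3) with
  \<open>s = N\<close> and all \<open>\<lambda>\<^sub>i = 1\<close>, as the sums over nonempty subsets are then positive integers.

  The substance is that (1) implies (2). For \<open>\<alpha>\<^sub>i = \<beta> + \<mu>\<^sub>i \<gamma>\<close> the sum in (1) equals
  \<open>\<Sum>\<^sub>k p\<^sub>k(\<mu>) c\<^sub>k\<close> with the weighted power sums \<open>p\<^sub>k(\<mu>) = \<Sum>\<^sub>i \<lambda>\<^sub>i \<mu>\<^sub>i\<^sup>k\<close>, where \<open>p\<^sub>0 = \<Sum>\<^sub>i \<lambda>\<^sub>i\<close> is constant. If
  \<open>c\<^sub>0 = \<Sum>\<^sub>k u\<^sub>k c\<^sub>k\<close> were in the span of the others, any \<open>\<mu>\<close> with \<open>p\<^sub>k(\<mu>) = - p\<^sub>0 u\<^sub>k\<close> for \<open>1 \<le> k \<le> N\<close> would make the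
  sum vanish. Hence it suffices that \<open>(p\<^sub>1, \<dots>, p\<^sub>N)\<close> maps \<open>\<complex>\<^sup>N\<close> onto \<open>\<complex>\<^sup>N\<close>, which is
  \<open>weighted_power_sums_surjective\<close>. The condition on subset sums enters here: it says that the origin is
  the only common zero of \<open>p\<^sub>1, \<dots>, p\<^sub>N\<close> (\<open>weighted_power_sums_zero\<close>).

  Surjectivity is then a matter of projective dimension. The \<open>N\<close> forms \<open>p\<^sub>k - a\<^sub>k x\<^sub>0\<^sup>k\<close> in the \<open>N + 1\<close> variables
  \<open>x\<^sub>0, \<dots>, x\<^sub>N\<close> have a nontrivial common zero (\<open>forms_have_common_zero\<close>), it has \<open>x\<^sub>0 \<noteq> 0\<close>, and rescaling
  to \<open>x\<^sub>0 = 1\<close> solves \<open>p\<^sub>k(\<mu>) = a\<^sub>k\<close>. The common zero comes from an elementary version of elimination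
  theory. By a Nullstellensatz that rests on the uncountability of \<open>\<complex>\<close> (\<open>weak_Nullstellensatz\<close>),
  forms without nontrivial common zero generate an ideal that contains a power of each variable
  (\<open>Var_power_in_ideal\<close>). Then the polynomial ring is a finite module over the algebra generated by the
  \<open>N\<close> forms, and counting dimensions contradicts its growth of order \<open>N + 1\<close>.
\<close>

section \<open>Polynomials in a variable number of variables\<close>

text \<open>
  The number of variables in the argument is \<open>d\<close>, which is a term and hence cannot index a type. All
  polynomials therefore live in one ring with the variables \<open>x\<^sub>0, x\<^sub>1, x\<^sub>2, \<dots>\<close>, and the polynomials in
  \<open>x\<^sub>0, \<dots>, x\<^sub>N\<close> form the subring \<open>polys N\<close> below. The monomials in these variables are \<open>mons N\<close>.
\<close>

type_synonym npoly = "(nat \<Rightarrow>\<^sub>0 nat) \<Rightarrow>\<^sub>0 complex"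

abbreviation Const :: "complex \<Rightarrow> npoly" where
  "Const c \<equiv> Poly_Mapping.single 0 c"

abbreviation monom_of :: "(nat \<Rightarrow>\<^sub>0 nat) \<Rightarrow> npoly" where
  "monom_of m \<equiv> Poly_Mapping.single m 1"

abbreviation Var :: "nat \<Rightarrow> npoly" where
  "Var i \<equiv> monom_of (Poly_Mapping.single i (Suc 0))"

definition mons :: "nat \<Rightarrow> (nat \<Rightarrow>\<^sub>0 nat) set" where
  "mons N = {m. Poly_Mapping.keys m \<subseteq> {..N}}"

text \<open>
  On \<open>mons N\<close> this is the total degree. Cutting the sum off at \<open>N\<close> makes it additive on all monomials.
\<close>

definition mon_degree :: "nat \<Rightarrow> (nat \<Rightarrow>\<^sub>0 nat) \<Rightarrow> nat" where
  "mon_degree N m = (\<Sum>i\<le>N. Poly_Mapping.lookup m i)"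

definition polys :: "nat \<Rightarrow> npoly set" where
  "polys N = {p. Poly_Mapping.keys p \<subseteq> mons N}"

text \<open>
  These boxes exhaust \<open>mons N\<close>, and their exact size \<open>(n + 1) ^ (N + 1)\<close> is what the dimension
  count below compares.
\<close>

definition mon_box :: "nat \<Rightarrow> nat \<Rightarrow> (nat \<Rightarrow>\<^sub>0 nat) set" where
  "mon_box N n = {m \<in> mons N. \<forall>i. Poly_Mapping.lookup m i \<le> n}"

interpretation npoly: vector_space "\<lambda>c p. Const c * p"
  by unfold_locales (simp_all add: algebra_simps single_add mult_single flip: mult.assoc)

lemma Const_add: "Const (a + b) = Const a + Const b"
  by (simp add: single_add)

lemma Const_diff: "Const (a - b) = Const a - Const b"
  by (simp add: single_diff)

lemma Const_uminus: "Const (- a) = - Const a"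
  by (simp add: single_uminus)

lemma Const_mult: "Const (a * b) = Const a * Const b"
  by (simp add: mult_single)

lemma Const_sum: "Const (sum f A) = (\<Sum>i\<in>A. Const (f i))"
  by (induction A rule: infinite_finite_induct) (simp_all add: Const_add)

lemma Var_power: "Var i ^ n = monom_of (Poly_Mapping.single i n)"
  by (induction n) (simp_all add: mult_single flip: single_add)

lemma mons_zero [simp]: "0 \<in> mons N"
  by (simp add: mons_def)

lemma mons_add: "a \<in> mons N \<Longrightarrow> b \<in> mons N \<Longrightarrow> a + b \<in> mons N"
  using keys_add[of a b] unfolding mons_def by blast

lemma mons_single: "i \<le> N \<Longrightarrow> Poly_Mapping.single i n \<in> mons N"
  by (simp add: mons_def)

lemma mon_degree_add [simp]: "mon_degree N (a + b) = mon_degree N a + mon_degree N b"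
  by (simp add: mon_degree_def lookup_add sum.distrib)

lemma mon_degree_single: "i \<le> N \<Longrightarrow> mon_degree N (Poly_Mapping.single i n) = n"
  by (simp add: mon_degree_def lookup_single when_def)

lemma polys_add: "p \<in> polys N \<Longrightarrow> q \<in> polys N \<Longrightarrow> p + q \<in> polys N"
  using keys_add[of p q] unfolding polys_def by blast

lemma polys_diff: "p \<in> polys N \<Longrightarrow> q \<in> polys N \<Longrightarrow> p - q \<in> polys N"
  using keys_diff[of p q] unfolding polys_def by blast

lemma polys_mult: "p \<in> polys N \<Longrightarrow> q \<in> polys N \<Longrightarrow> p * q \<in> polys N"
  using keys_mult[of p q] unfolding polys_def by (auto intro!: mons_add)

lemma polys_Const: "Const c \<in> polys N"
  by (simp add: polys_def)

lemma polys_zero: "0 \<in> polys N"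
  by (simp add: polys_def)

lemma polys_one: "1 \<in> polys N"
  by (simp add: polys_def)

lemma polys_Var: "i \<le> N \<Longrightarrow> Var i \<in> polys N"
  by (simp add: polys_def mons_single)

lemma polys_sum: "(\<And>i. i \<in> A \<Longrightarrow> f i \<in> polys N) \<Longrightarrow> sum f A \<in> polys N"
  by (induction A rule: infinite_finite_induct) (simp_all add: polys_add polys_zero)

lemma polys_prod: "(\<And>i. i \<in> A \<Longrightarrow> f i \<in> polys N) \<Longrightarrow> prod f A \<in> polys N"
  by (induction A rule: infinite_finite_induct) (simp_all add: polys_mult polys_one)

lemma polys_power: "p \<in> polys N \<Longrightarrow> p ^ n \<in> polys N"
  by (induction n) (simp_all add: polys_mult polys_one)

lemma npoly_expand:
  fixes p :: npoly
  shows "p = (\<Sum>m\<in>Poly_Mapping.keys p. Const (Poly_Mapping.lookup p m) * monom_of m)"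
  by (rule poly_mapping_eqI)
     (simp add: lookup_sum mult_single lookup_single when_def in_keys_iff)

lemma in_span_monomials:
  assumes "Poly_Mapping.keys p \<subseteq> M"
  shows "p \<in> npoly.span (monom_of ` M)"
  by (subst npoly_expand, intro npoly.span_sum npoly.span_scale npoly.span_base)
     (use assms in auto)

lemma independent_monomials: "npoly.independent (monom_of ` M)"
proof
  assume "npoly.dependent (monom_of ` M)"
  then obtain t u v where t: "finite t" "t \<subseteq> monom_of ` M"
      "(\<Sum>v\<in>t. Const (u v) * v) = 0" "v \<in> t" "u v \<noteq> 0"
    unfolding npoly.dependent_explicit by blast
  from t(4,2) obtain m where m: "v = monom_of m" by auto
  have "0 = (\<Sum>w\<in>t. Poly_Mapping.lookup (Const (u w) * w) m)"
    using t(3) by (simp flip: lookup_sum)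
  also have "\<dots> = (\<Sum>w\<in>t. if w = v then u v else 0)"
    using t(2) by (intro sum.cong) (auto simp: m mult_single lookup_single when_def)
  also have "\<dots> = u v" using t(1,4) by simp
  finally show False using t(5) by simp
qed

lemma card_mon_box: "card (mon_box N n) = (n + 1) ^ (N + 1)"
  and finite_mon_box: "finite (mon_box N n)"
proof -
  let ?e = "\<lambda>m. restrict (Poly_Mapping.lookup m) {..N}"
  let ?d = "\<lambda>e. Poly_Mapping.Abs_poly_mapping (\<lambda>i. if i \<le> N then e i else (0::nat))"
  have l: "Poly_Mapping.lookup (?d e) i = (if i \<le> N then e i else 0)" for e i
    by (subst lookup_Abs_poly_mapping) (auto intro: finite_subset[of _ "{..N}"])
  have "bij_betw ?e (mon_box N n) (PiE {..N} (\<lambda>_. {..n}))"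
  proof (rule bij_betw_byWitness[where f' = ?d])
    show "\<forall>m\<in>mon_box N n. ?d (?e m) = m"
      by (auto intro!: poly_mapping_eqI simp: l mon_box_def mons_def in_keys_iff)
    show "\<forall>e\<in>PiE {..N} (\<lambda>_. {..n}). ?e (?d e) = e"
      by (auto simp: l restrict_def PiE_def extensional_def intro!: ext)
    show "?e ` mon_box N n \<subseteq> PiE {..N} (\<lambda>_. {..n})"
      by (auto simp: mon_box_def split: if_splits)
    show "?d ` PiE {..N} (\<lambda>_. {..n}) \<subseteq> mon_box N n"
      by (auto simp: mon_box_def mons_def l in_keys_iff split: if_splits)
  qed
  from bij_betw_same_card[OF this] bij_betw_finite[OF this]
  show "card (mon_box N n) = (n + 1) ^ (N + 1)" "finite (mon_box N n)"
    by (simp_all add: card_PiE finite_PiE)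
qed

lemma keys_subset_mon_box:
  assumes "p \<in> polys N"
  shows "\<exists>n. Poly_Mapping.keys p \<subseteq> mon_box N n"
proof
  let ?n = "\<Sum>m\<in>Poly_Mapping.keys p. mon_degree N m"
  show "Poly_Mapping.keys p \<subseteq> mon_box N ?n"
  proof
    fix m assume m: "m \<in> Poly_Mapping.keys p"
    have M: "m \<in> mons N" using m assms by (auto simp: polys_def)
    have "Poly_Mapping.lookup m i \<le> ?n" for i
    proof (cases "i \<le> N")
      case True
      have "Poly_Mapping.lookup m i \<le> mon_degree N m"
        unfolding mon_degree_def using True by (intro member_le_sum) auto
      also have "\<dots> \<le> ?n" using m by (intro member_le_sum) auto
      finally show ?thesis .
    next
      case False
      then have "i \<notin> Poly_Mapping.keys m" using M by (auto simp: mons_def)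
      then show ?thesis by (simp add: in_keys_iff)
    qed
    with M show "m \<in> mon_box N ?n" by (simp add: mon_box_def)
  qed
qed

section \<open>A Nullstellensatz over the complex numbers\<close>

text \<open>
  A submodule over \<open>polys N\<close> of the ambient ring. Such an \<open>I\<close> meets \<open>polys N\<close> in an ideal, and this ideal
  is proper exactly if \<open>1 \<notin> I\<close>.
\<close>

definition is_ideal :: "nat \<Rightarrow> npoly set \<Rightarrow> bool" where
  "is_ideal N I \<longleftrightarrow> 0 \<in> I \<and> (\<forall>a\<in>I. \<forall>b\<in>I. a + b \<in> I) \<and> (\<forall>r\<in>polys N. \<forall>a\<in>I. r * a \<in> I)"

definition adjoin :: "nat \<Rightarrow> npoly set \<Rightarrow> npoly \<Rightarrow> npoly set" where
  "adjoin N I g = {a + g * r | a r. a \<in> I \<and> r \<in> polys N}"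

lemma
  assumes "is_ideal N I"
  shows ideal_zero: "0 \<in> I"
    and ideal_add: "a \<in> I \<Longrightarrow> b \<in> I \<Longrightarrow> a + b \<in> I"
    and ideal_mult: "r \<in> polys N \<Longrightarrow> a \<in> I \<Longrightarrow> r * a \<in> I"
  using assms by (auto simp: is_ideal_def)

lemma ideal_uminus: "is_ideal N I \<Longrightarrow> a \<in> I \<Longrightarrow> - a \<in> I"
  using ideal_mult[of N I "Const (-1)" a] polys_Const[of "-1" N] by (simp add: Const_uminus)

lemma ideal_diff: "is_ideal N I \<Longrightarrow> a \<in> I \<Longrightarrow> b \<in> I \<Longrightarrow> a - b \<in> I"
  using ideal_add[of N I a "- b"] ideal_uminus[of N I b] by simp

lemma ideal_sum: "is_ideal N I \<Longrightarrow> (\<And>i. i \<in> A \<Longrightarrow> f i \<in> I) \<Longrightarrow> sum f A \<in> I"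
  by (induction A rule: infinite_finite_induct) (simp_all add: ideal_add ideal_zero)

lemma is_ideal_adjoin:
  assumes I: "is_ideal N I"
  shows "is_ideal N (adjoin N I g)"
  unfolding is_ideal_def
proof (intro conjI ballI)
  have "0 = 0 + g * 0" by simp
  then show "0 \<in> adjoin N I g" unfolding adjoin_def using ideal_zero[OF I] polys_zero by blast
next
  fix p q assume "p \<in> adjoin N I g" "q \<in> adjoin N I g"
  then obtain a r b s where "p = a + g * r" "q = b + g * s" "a \<in> I" "b \<in> I" "r \<in> polys N" "s \<in> polys N"
    unfolding adjoin_def by blast
  moreover from this have "p + q = (a + b) + g * (r + s)" by (simp add: algebra_simps)
  ultimately show "p + q \<in> adjoin N I g"
    unfolding adjoin_def using ideal_add[OF I] polys_add by blast
next
  fix t p assume t: "t \<in> polys N" and "p \<in> adjoin N I g"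
  then obtain a r where "p = a + g * r" "a \<in> I" "r \<in> polys N"
    unfolding adjoin_def by blast
  moreover from this have "t * p = t * a + g * (t * r)" by (simp add: algebra_simps)
  ultimately show "t * p \<in> adjoin N I g"
    unfolding adjoin_def using ideal_mult[OF I t] polys_mult[OF t] by blast
qed

lemma subset_adjoin: "I \<subseteq> adjoin N I g"
proof
  fix a assume "a \<in> I"
  moreover have "a = a + g * 0" by simp
  ultimately show "a \<in> adjoin N I g" unfolding adjoin_def using polys_zero by blast
qed

lemma generator_in_adjoin:
  assumes "is_ideal N I" shows "g \<in> adjoin N I g"
proof -
  have "g = 0 + g * 1" by simp
  then show ?thesis unfolding adjoin_def using ideal_zero[OF assms] polys_one by blast
qed

lemma proper_ideal_no_Const:
  assumes "is_ideal N I" "1 \<notin> I" "Const a \<in> I"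
  shows "a = 0"
proof (rule ccontr)
  assume "a \<noteq> 0"
  have "Const (1 / a) * Const a \<in> I" by (intro ideal_mult[OF assms(1)] polys_Const assms)
  with \<open>a \<noteq> 0\<close> assms(2) show False by (simp add: mult_single)
qed

definition subst_var :: "npoly \<Rightarrow> complex poly \<Rightarrow> npoly" where
  "subst_var x q = poly (map_poly Const q) x"

lemma subst_var_pCons: "subst_var x (pCons a q) = Const a + x * subst_var x q"
  by (simp add: subst_var_def map_poly_pCons)

lemma subst_var_add: "subst_var x (p + q) = subst_var x p + subst_var x q"
proof -
  have "map_poly Const (p + q) = map_poly Const p + map_poly Const q"
    by (rule poly_eqI) (simp add: coeff_map_poly Const_add)
  then show ?thesis by (simp add: subst_var_def)
qed

lemma subst_var_smult: "subst_var x (smult a q) = Const a * subst_var x q"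
proof -
  have "map_poly Const (smult a q) = smult (Const a) (map_poly Const q)"
    by (rule poly_eqI) (simp add: coeff_map_poly Const_mult)
  then show ?thesis by (simp add: subst_var_def)
qed

lemma subst_var_0: "subst_var x 0 = 0"
  by (simp add: subst_var_def)

lemma subst_var_mult: "subst_var x (p * q) = subst_var x p * subst_var x q"
  by (induction p)
     (simp_all add: subst_var_0 subst_var_pCons subst_var_add subst_var_smult algebra_simps)

lemma subst_var_sum: "subst_var x (sum f A) = (\<Sum>i\<in>A. subst_var x (f i))"
  by (induction A rule: infinite_finite_induct) (simp_all add: subst_var_0 subst_var_add)

lemma subst_var_prod: "subst_var x (prod f A) = (\<Prod>i\<in>A. subst_var x (f i))"
proof -
  have "subst_var x 1 = 1" by (simp add: subst_var_pCons subst_var_0 flip: pCons_one)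
  then show ?thesis
    by (induction A rule: infinite_finite_induct) (simp_all add: subst_var_mult)
qed

lemma subst_var_linear: "subst_var x [:- c, 1:] = x - Const c"
  by (simp add: subst_var_pCons subst_var_0 Const_uminus)

lemma subst_var_in_polys: "x \<in> polys N \<Longrightarrow> subst_var x q \<in> polys N"
  by (induction q)
     (simp_all add: subst_var_0 subst_var_pCons polys_zero polys_add polys_Const polys_mult)

text \<open>
  A nonzero \<open>q\<close> splits over \<open>\<complex>\<close> into factors \<open>T - z\<close>. If every \<open>x - z\<close> is invertible modulo \<open>I\<close>, then
  cancelling the factors of \<open>q(x) \<in> I\<close> one after the other ends with a nonzero constant in \<open>I\<close>.
\<close>

lemma ideal_improper_if_algebraic:
  assumes I: "is_ideal N I" and x: "x \<in> polys N"
    and inv: "\<And>c. \<exists>r\<in>polys N. 1 - (x - Const c) * r \<in> I"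
    and q: "q \<noteq> 0" "subst_var x q \<in> I"
  shows "1 \<in> I"
  using q
proof (induction "degree q" arbitrary: q rule: less_induct)
  case (less q)
  show ?case
  proof (cases "degree q = 0")
    case True
    then obtain a where a: "q = [:a:]" by (rule degree_eq_zeroE)
    then show ?thesis
      using proper_ideal_no_Const[OF I, of a] less.prems by (auto simp: subst_var_pCons subst_var_0)
  next
    case False
    then obtain z where "poly q z = 0"
      using fundamental_theorem_of_algebra[of q] by (auto simp: constant_degree)
    then obtain q' where q': "q = [:- z, 1:] * q'"
      by (auto simp: poly_eq_0_iff_dvd elim: dvdE)
    from q' less.prems have "q' \<noteq> 0" by auto
    then have deg: "degree q' < degree q" unfolding q' by (subst degree_mult_eq) auto
    obtain r where r: "r \<in> polys N" "1 - (x - Const z) * r \<in> I" using inv by blast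
    \<comment> \<open>Multiplying \<open>q(x)\<close> by the inverse \<open>r\<close> of \<open>x - z\<close> modulo \<open>I\<close> leaves \<open>q'(x)\<close>.\<close>
    have "r * subst_var x q + subst_var x q' * (1 - (x - Const z) * r) \<in> I"
      by (intro ideal_add[OF I] ideal_mult[OF I] r less.prems subst_var_in_polys x)
    also have "r * subst_var x q + subst_var x q' * (1 - (x - Const z) * r) = subst_var x q'"
      unfolding q' subst_var_mult subst_var_linear by (simp add: algebra_simps)
    finally show ?thesis using less.hyps[OF deg \<open>q' \<noteq> 0\<close>] by blast
  qed
qed

text \<open>
  Otherwise \<open>x - c\<close> has an inverse \<open>r c\<close> modulo \<open>I\<close> for every \<open>c \<in> \<complex>\<close>. There are uncountably many \<open>c\<close>, but
  the polynomials are a countable union of finite-dimensional spaces, so one of these spaces contains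
  infinitely many \<open>r c\<close> and there is a nontrivial relation \<open>\<Sum>c\<in>C. a c * r c = 0\<close>. Clearing the
  denominators \<open>x - c\<close> in it gives a nonzero univariate polynomial \<open>Q\<close> with \<open>Q(x) \<in> I\<close>, which is
  excluded by the preceding lemma. This is the form of the Nullstellensatz argument for uncountable
  fields that specialises one element at a time.
\<close>

lemma ideal_specialise:
  assumes I: "is_ideal N I" and proper: "1 \<notin> I" and x: "x \<in> polys N"
  shows "\<exists>c. 1 \<notin> adjoin N I (x - Const c)"
proof (rule ccontr)
  assume "\<nexists>c. 1 \<notin> adjoin N I (x - Const c)"
  then have all: "1 \<in> adjoin N I (x - Const c)" for c by blast
  have inv: "\<exists>r\<in>polys N. 1 - (x - Const c) * r \<in> I" for c
  proof -
    obtain a r where "1 = a + (x - Const c) * r" "a \<in> I" "r \<in> polys N"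
      using all[of c] unfolding adjoin_def by blast
    then show ?thesis by (intro bexI[of _ r]) (simp_all add: algebra_simps)
  qed
  then obtain r where r: "\<And>c. r c \<in> polys N" "\<And>c. 1 - (x - Const c) * r c \<in> I" by metis
  \<comment> \<open>Two equal inverses \<open>r c\<close> and \<open>r c'\<close> would lie in \<open>I\<close>, because \<open>(c' - c) * r c \<in> I\<close>.\<close>
  have "inj r"
  proof (rule injI, rule ccontr)
    fix c c' assume eq: "r c = r c'" and "c \<noteq> c'"
    have "(1 - (x - Const c') * r c) - (1 - (x - Const c) * r c) \<in> I"
      using ideal_diff[OF I r(2)[of c'] r(2)[of c]] by (simp only: eq)
    then have "Const (1 / (c' - c)) * ((1 - (x - Const c') * r c) - (1 - (x - Const c) * r c)) \<in> I"
      by (intro ideal_mult[OF I] polys_Const)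
    also have "(1 - (x - Const c') * r c) - (1 - (x - Const c) * r c) = Const (c' - c) * r c"
      by (simp add: algebra_simps Const_diff)
    also have "Const (1 / (c' - c)) * (Const (c' - c) * r c) = r c"
      using \<open>c \<noteq> c'\<close> by (simp add: mult_single flip: mult.assoc)
    finally have "(1 - (x - Const c) * r c) + (x - Const c) * r c \<in> I"
      by (intro ideal_add[OF I] r ideal_mult[OF I] polys_diff x polys_Const)
    then show False using proper by simp
  qed
  have "\<exists>n. infinite {c. Poly_Mapping.keys (r c) \<subseteq> mon_box N n}"
  proof (rule ccontr)
    assume "\<nexists>n. infinite {c. Poly_Mapping.keys (r c) \<subseteq> mon_box N n}"
    then have "countable (\<Union>n. {c. Poly_Mapping.keys (r c) \<subseteq> mon_box N n})"
      by (intro countable_UN) (auto intro: countable_finite)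
    also have "(\<Union>n. {c. Poly_Mapping.keys (r c) \<subseteq> mon_box N n}) = (UNIV :: complex set)"
      using keys_subset_mon_box[OF r(1)] by auto
    finally show False using uncountable_UNIV_complex by blast
  qed
  then obtain n where n: "infinite {c. Poly_Mapping.keys (r c) \<subseteq> mon_box N n}" (is "infinite ?S") ..
  have "infinite (r ` ?S)"
    using n \<open>inj r\<close> by (metis finite_imageD inj_on_subset subset_UNIV)
  moreover have "r ` ?S \<subseteq> npoly.span (monom_of ` mon_box N n)"
    by (auto intro: in_span_monomials)
  ultimately have "npoly.dependent (r ` ?S)"
    using npoly.independent_span_bound[of "monom_of ` mon_box N n" "r ` ?S"] finite_mon_box
    by blast
  then obtain t u v where t: "finite t" "t \<subseteq> r ` ?S"
      "(\<Sum>v\<in>t. Const (u v) * v) = 0" "v \<in> t" "u v \<noteq> 0"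
    unfolding npoly.dependent_explicit by blast
  then obtain C where C: "finite C" "t = r ` C"
    by (meson finite_subset_image)
  define a where "a c = u (r c)" for c
  obtain c0 where c0: "c0 \<in> C" "a c0 \<noteq> 0" using t(4,5) C by (auto simp: a_def)
  have rel: "(\<Sum>c\<in>C. Const (a c) * r c) = 0"
    using t(3) \<open>inj r\<close> unfolding C(2) a_def by (subst (asm) sum.reindex) (auto intro: inj_on_subset)
  \<comment> \<open>\<open>Q\<close> is the numerator of \<open>\<Sum>c\<in>C. a c / (T - c)\<close>, and it is nonzero at the pole \<open>c0\<close>.\<close>
  define Q where "Q = (\<Sum>c\<in>C. smult (a c) (\<Prod>c'\<in>C - {c}. [:- c', 1:]))"
  have "poly Q c0 = (\<Sum>c\<in>C. a c * (\<Prod>c'\<in>C - {c}. c0 - c'))"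
    by (simp add: Q_def poly_sum poly_prod)
  also have "\<dots> = (\<Sum>c\<in>C. if c = c0 then a c0 * (\<Prod>c'\<in>C - {c0}. c0 - c') else 0)"
    using C(1) c0(1) by (intro sum.cong) (auto intro!: prod_zero)
  also have "\<dots> = a c0 * (\<Prod>c'\<in>C - {c0}. c0 - c')" using C(1) c0(1) by simp
  also have "\<dots> \<noteq> 0" using C(1) c0(2) by auto
  finally have "Q \<noteq> 0" by auto
  have "subst_var x Q = (\<Sum>c\<in>C. Const (a c) * (\<Prod>c'\<in>C - {c}. x - Const c'))"
    by (simp add: Q_def subst_var_sum subst_var_smult subst_var_prod subst_var_linear)
  also have "\<dots> = (\<Sum>c\<in>C. (Const (a c) * (\<Prod>c'\<in>C - {c}. x - Const c')) * (1 - (x - Const c) * r c)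
                        + (\<Prod>c'\<in>C. x - Const c') * (Const (a c) * r c))"
    using C(1) by (intro sum.cong refl) (simp add: prod.remove[where A = C] algebra_simps)
  also have "\<dots> = (\<Sum>c\<in>C. (Const (a c) * (\<Prod>c'\<in>C - {c}. x - Const c')) * (1 - (x - Const c) * r c))"
    by (simp add: sum.distrib rel flip: sum_distrib_left)
  also have "\<dots> \<in> I"
    by (intro ideal_sum[OF I] ideal_mult[OF I] polys_mult polys_prod polys_diff polys_Const x r)
  finally show False
    using ideal_improper_if_algebraic[OF I x inv \<open>Q \<noteq> 0\<close>] proper by blast
qed

text \<open>
  The point \<open>c\<close> is a common zero of the members of \<open>I\<close> in \<open>polys N\<close>. Indeed, modulo the proper ideal
  \<open>J\<close>, every variable \<open>x\<^sub>i\<close> with \<open>i \<le> N\<close> is congruent to \<open>c i\<close>, so each such member is congruent to its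
  value at \<open>c\<close>, and a constant in \<open>J\<close> is zero. In this form no evaluation homomorphism has to be set
  up. The ideal \<open>J\<close> is reached by specialising the variables one after the other.
\<close>

lemma weak_Nullstellensatz:
  assumes I: "is_ideal N I" and proper: "1 \<notin> I"
  shows "\<exists>c J. is_ideal N J \<and> 1 \<notin> J \<and> I \<subseteq> J \<and> (\<forall>i\<le>N. Var i - Const (c i) \<in> J)"
proof -
  have "\<exists>c J. is_ideal N J \<and> 1 \<notin> J \<and> I \<subseteq> J \<and> (\<forall>i<n. Var i - Const (c i) \<in> J)"
    if "n \<le> Suc N" for n
    using that
  proof (induction n)
    case 0
    then show ?case using assms by blast
  next
    case (Suc n)
    then obtain c J where J: "is_ideal N J" "1 \<notin> J" "I \<subseteq> J" "\<forall>i<n. Var i - Const (c i) \<in> J"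
      by auto
    obtain z where z: "1 \<notin> adjoin N J (Var n - Const z)"
      using ideal_specialise[OF J(1,2) polys_Var, of n] Suc.prems by auto
    let ?K = "adjoin N J (Var n - Const z)"
    have "\<forall>i<Suc n. Var i - Const ((c(n := z)) i) \<in> ?K"
      using J(4) subset_adjoin[of J N] generator_in_adjoin[OF J(1)] by (auto simp: less_Suc_eq)
    then show ?case
      using is_ideal_adjoin[OF J(1)] z J(3) subset_adjoin[of J N] by blast
  qed
  from this[of "Suc N"] show ?thesis by (simp add: less_Suc_eq_le)
qed

section \<open>Common zeros of forms\<close>

definition is_form :: "nat \<Rightarrow> nat \<Rightarrow> npoly \<Rightarrow> bool" where
  "is_form N n p \<longleftrightarrow> p \<in> polys N \<and> (\<forall>m\<in>Poly_Mapping.keys p. mon_degree N m = n)"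

definition homogeneous_part :: "nat \<Rightarrow> nat \<Rightarrow> npoly \<Rightarrow> npoly" where
  "homogeneous_part N n p = (\<Sum>m\<in>{m \<in> Poly_Mapping.keys p. mon_degree N m = n}.
     Poly_Mapping.single m (Poly_Mapping.lookup p m))"

lemma lookup_homogeneous_part:
  "Poly_Mapping.lookup (homogeneous_part N n p) m = (if mon_degree N m = n then Poly_Mapping.lookup p m else 0)"
  by (auto simp: homogeneous_part_def lookup_sum lookup_single when_def in_keys_iff)

lemma homogeneous_part_add: "homogeneous_part N n (p + q) = homogeneous_part N n p + homogeneous_part N n q"
  by (rule poly_mapping_eqI) (simp add: lookup_homogeneous_part lookup_add)

lemma homogeneous_part_diff: "homogeneous_part N n (p - q) = homogeneous_part N n p - homogeneous_part N n q"
  by (rule poly_mapping_eqI) (simp add: lookup_homogeneous_part lookup_minus)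

lemma homogeneous_part_sum: "homogeneous_part N n (sum f A) = (\<Sum>i\<in>A. homogeneous_part N n (f i))"
  by (rule poly_mapping_eqI) (simp add: lookup_homogeneous_part lookup_sum)

lemma homogeneous_part_eq_self: "(\<And>m. m \<in> Poly_Mapping.keys p \<Longrightarrow> mon_degree N m = n) \<Longrightarrow> homogeneous_part N n p = p"
  by (rule poly_mapping_eqI) (auto simp: lookup_homogeneous_part in_keys_iff)

lemma homogeneous_part_eq_0: "(\<And>m. m \<in> Poly_Mapping.keys p \<Longrightarrow> mon_degree N m \<noteq> n) \<Longrightarrow> homogeneous_part N n p = 0"
  by (rule poly_mapping_eqI) (auto simp: lookup_homogeneous_part in_keys_iff)

lemma keys_homogeneous_part: "Poly_Mapping.keys (homogeneous_part N n p) = {m \<in> Poly_Mapping.keys p. mon_degree N m = n}"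
  by (auto simp: in_keys_iff lookup_homogeneous_part split: if_splits)

lemma homogeneous_part_in_polys: "p \<in> polys N \<Longrightarrow> homogeneous_part N n p \<in> polys N"
  by (auto simp: polys_def keys_homogeneous_part)

text \<open>
  Multiplication by a form of degree \<open>k\<close> shifts components by \<open>k\<close>: split \<open>r\<close> into its component of degree
  \<open>n - k\<close> and a rest without monomials of that degree, which cannot contribute to degree \<open>n\<close>.
\<close>

lemma homogeneous_part_form_mult:
  assumes f: "is_form N k f"
  shows "homogeneous_part N n (f * r) = (if k \<le> n then f * homogeneous_part N (n - k) r else 0)"
proof (cases "k \<le> n")
  case True
  let ?s = "r - homogeneous_part N (n - k) r"
  have "homogeneous_part N n (f * homogeneous_part N (n - k) r) = f * homogeneous_part N (n - k) r"
    using keys_mult[of f "homogeneous_part N (n - k) r"] f True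
    by (intro homogeneous_part_eq_self) (auto simp: keys_homogeneous_part is_form_def)
  moreover have "homogeneous_part N n (f * ?s) = 0"
  proof (rule homogeneous_part_eq_0)
    fix m assume "m \<in> Poly_Mapping.keys (f * ?s)"
    then obtain a b where "m = a + b" "a \<in> Poly_Mapping.keys f" "b \<in> Poly_Mapping.keys ?s"
      using keys_mult[of f ?s] by blast
    then show "mon_degree N m \<noteq> n"
      using f by (auto simp: is_form_def in_keys_iff lookup_minus lookup_homogeneous_part)
  qed
  moreover have "f * r = f * homogeneous_part N (n - k) r + f * ?s" by (simp add: algebra_simps)
  ultimately show ?thesis using True by (simp add: homogeneous_part_add)
next
  case False
  then show ?thesis
    using keys_mult[of f r] f by (auto intro!: homogeneous_part_eq_0 simp: is_form_def)
qed

lemma is_form_Var_power: "i \<le> N \<Longrightarrow> is_form N n (Var i ^ n)"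
  using polys_power[OF polys_Var, of i N n] by (simp add: is_form_def Var_power mon_degree_single)

definition ideal_gen :: "nat \<Rightarrow> 'k set \<Rightarrow> ('k \<Rightarrow> npoly) \<Rightarrow> npoly set" where
  "ideal_gen N K f = {(\<Sum>k\<in>K. f k * r k) | r. \<forall>k\<in>K. r k \<in> polys N}"

lemma is_ideal_gen: "is_ideal N (ideal_gen N K f)"
  unfolding is_ideal_def
proof (intro conjI ballI)
  show "0 \<in> ideal_gen N K f" unfolding ideal_gen_def
    by (auto intro!: exI[of _ "\<lambda>_. 0"] simp: polys_zero)
next
  fix a b assume "a \<in> ideal_gen N K f" "b \<in> ideal_gen N K f"
  then obtain r s where "a = (\<Sum>k\<in>K. f k * r k)" "b = (\<Sum>k\<in>K. f k * s k)"
    "\<forall>k\<in>K. r k \<in> polys N" "\<forall>k\<in>K. s k \<in> polys N" unfolding ideal_gen_def by blast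
  then show "a + b \<in> ideal_gen N K f" unfolding ideal_gen_def
    by (auto intro!: exI[of _ "\<lambda>k. r k + s k"] polys_add simp: algebra_simps sum.distrib)
next
  fix t a assume "t \<in> polys N" "a \<in> ideal_gen N K f"
  then obtain r where "a = (\<Sum>k\<in>K. f k * r k)" "\<forall>k\<in>K. r k \<in> polys N"
    unfolding ideal_gen_def by blast
  with \<open>t \<in> polys N\<close> show "t * a \<in> ideal_gen N K f" unfolding ideal_gen_def
    by (auto intro!: exI[of _ "\<lambda>k. t * r k"] polys_mult simp: algebra_simps sum_distrib_left)
qed

lemma generator_in_ideal_gen:
  assumes "finite K" "k \<in> K"
  shows "f k \<in> ideal_gen N K f"
proof -
  have "f k = (\<Sum>j\<in>K. f j * (if j = k then 1 else 0))"
    using assms by (simp add: if_distrib[of "\<lambda>x. _ * x"] cong: if_cong)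
  moreover have "\<forall>j\<in>K. (if j = k then 1 else 0) \<in> polys N" by (simp add: polys_one polys_zero)
  ultimately show ?thesis unfolding ideal_gen_def
    by (intro CollectI exI[of _ "\<lambda>j. if j = k then 1 else 0"]) simp
qed

text \<open>
  An ideal generated by forms is homogeneous, and the component of degree \<open>n\<close> of a member has
  cofactors \<open>r k\<close> that are forms of the complementary degree \<open>n - e k\<close>. This degree bound drives the
  induction in \<open>monomials_spanned\<close>.
\<close>

lemma homogeneous_part_ideal_gen:
  assumes f: "\<And>k. k \<in> K \<Longrightarrow> is_form N (e k) (f k)" and g: "g \<in> ideal_gen N K f"
  obtains r where "homogeneous_part N n g = (\<Sum>k\<in>K. f k * r k)" "\<And>k. k \<in> K \<Longrightarrow> r k \<in> polys N"
    "\<And>k m. k \<in> K \<Longrightarrow> m \<in> Poly_Mapping.keys (r k) \<Longrightarrow> mon_degree N m + e k = n"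
proof -
  obtain r where r: "g = (\<Sum>k\<in>K. f k * r k)" "\<And>k. k \<in> K \<Longrightarrow> r k \<in> polys N"
    using g unfolding ideal_gen_def by blast
  show thesis
  proof (rule that[of "\<lambda>k. if e k \<le> n then homogeneous_part N (n - e k) (r k) else 0"])
    show "homogeneous_part N n g = (\<Sum>k\<in>K. f k * (if e k \<le> n then homogeneous_part N (n - e k) (r k) else 0))"
      unfolding r(1) homogeneous_part_sum by (intro sum.cong refl) (simp add: homogeneous_part_form_mult[OF f])
  qed (use r(2) in \<open>auto simp: homogeneous_part_in_polys polys_zero keys_homogeneous_part split: if_splits\<close>)
qed

text \<open>
  If the forms have no common zero with \<open>x\<^sub>i = 1\<close>, then \<open>1 = g + (x\<^sub>i - 1) * r\<close> with \<open>g\<close> in the homogeneous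
  ideal \<open>J\<close> of the forms. Comparing components gives \<open>r\<^sub>0 \<equiv> -1\<close> and \<open>r\<^sub>n\<^sub>+\<^sub>1 \<equiv> x\<^sub>i * r\<^sub>n\<close> modulo \<open>J\<close>, that is
  \<open>r\<^sub>n \<equiv> - x\<^sub>i ^ n\<close>. As \<open>r\<^sub>n = 0\<close> for large \<open>n\<close>, a power of \<open>x\<^sub>i\<close> lies in \<open>J\<close>.
\<close>

lemma Var_power_in_ideal:
  assumes f: "\<And>k. k \<in> K \<Longrightarrow> is_form N (e k) (f k)" and i: "i \<le> N"
    and one: "1 \<in> adjoin N (ideal_gen N K f) (Var i - 1)"
  shows "\<exists>n. Var i ^ n \<in> ideal_gen N K f"
proof -
  let ?J = "ideal_gen N K f"
  have hJ: "homogeneous_part N n g \<in> ?J" if g: "g \<in> ?J" for g n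
  proof -
    obtain r where "homogeneous_part N n g = (\<Sum>k\<in>K. f k * r k)" "\<And>k. k \<in> K \<Longrightarrow> r k \<in> polys N"
      using homogeneous_part_ideal_gen[where e = e, OF f g] by metis
    then show ?thesis unfolding ideal_gen_def by blast
  qed
  obtain g r where gr: "1 = g + (Var i - 1) * r" "g \<in> ?J" "r \<in> polys N"
    using one unfolding adjoin_def by blast
  have eq: "g = 1 - Var i * r + r" using gr(1) by (simp add: algebra_simps)
  have hVar: "homogeneous_part N n (Var i * r) = (if 1 \<le> n then Var i * homogeneous_part N (n - 1) r else 0)" for n
    using homogeneous_part_form_mult[OF is_form_Var_power[OF i, of 1]] by simp
  have h1: "homogeneous_part N n 1 = (if n = 0 then 1 else 0)" for n
    using homogeneous_part_eq_self[of 1 N 0] homogeneous_part_eq_0[of 1 N n] by (simp add: mon_degree_def)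
  have claim: "Var i ^ n + homogeneous_part N n r \<in> ?J" for n
  proof (induction n)
    case 0
    have "homogeneous_part N 0 g = Var i ^ 0 + homogeneous_part N 0 r"
      unfolding eq by (simp add: homogeneous_part_add homogeneous_part_diff hVar h1)
    then show ?case using hJ[OF gr(2), of 0] by (simp only:)
  next
    case (Suc n)
    have "homogeneous_part N (Suc n) g = homogeneous_part N (Suc n) r - Var i * homogeneous_part N n r"
      unfolding eq by (simp add: homogeneous_part_add homogeneous_part_diff hVar h1)
    then have "Var i ^ Suc n + homogeneous_part N (Suc n) r = homogeneous_part N (Suc n) g + Var i * (Var i ^ n + homogeneous_part N n r)"
      by (simp add: algebra_simps)
    moreover have "\<dots> \<in> ?J"
      by (intro ideal_add[OF is_ideal_gen] ideal_mult[OF is_ideal_gen] hJ gr Suc polys_Var i)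
    ultimately show ?case by (simp only:)
  qed
  \<comment> \<open>This degree exceeds the degrees of all monomials of \<open>r\<close>.\<close>
  let ?n = "Suc (\<Sum>m\<in>Poly_Mapping.keys r. mon_degree N m)"
  have "homogeneous_part N ?n r = 0"
  proof (rule homogeneous_part_eq_0)
    fix m assume "m \<in> Poly_Mapping.keys r"
    then have "mon_degree N m \<le> (\<Sum>m\<in>Poly_Mapping.keys r. mon_degree N m)"
      by (intro member_le_sum) auto
    then show "mon_degree N m \<noteq> ?n" by simp
  qed
  then show ?thesis using claim[of ?n] by (intro exI[of _ ?n]) simp
qed

text \<open>
  If \<open>J\<close> contains \<open>x\<^sub>i ^ M\<close> for all \<open>i\<close>, then the polynomial ring is a module over \<open>\<complex>[f\<^sub>k]\<close> that is generated
  by the finitely many monomials in the box of size \<open>M\<close>. The lemma also bounds the exponents of the \<open>f\<^sub>k\<close> by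
  the degree: a monomial outside the box is divisible by some \<open>x\<^sub>i ^ M = \<Sum>k\<in>K. f k * r k\<close>, and since
  \<open>e k > 0\<close> the cofactors of the \<open>f k\<close> have smaller degree.
\<close>

lemma monomials_spanned:
  assumes K: "finite K" and f: "\<And>k. k \<in> K \<Longrightarrow> is_form N (e k) (f k)" and e: "\<And>k. k \<in> K \<Longrightarrow> e k > 0"
    and M: "\<And>i. i \<le> N \<Longrightarrow> Var i ^ M \<in> ideal_gen N K f"
    and m: "m \<in> mons N" "mon_degree N m \<le> n"
  shows "monom_of m \<in> npoly.span ((\<lambda>(\<alpha>, m). (\<Prod>k\<in>K. f k ^ \<alpha> k) * monom_of m) `
           (PiE K (\<lambda>_. {..n}) \<times> mon_box N M))"
  using m
proof (induction n arbitrary: m rule: less_induct)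
  case (less n m)
  define G where "G n = (\<lambda>(\<alpha>, m). (\<Prod>k\<in>K. f k ^ \<alpha> k) * monom_of m) `
           (PiE K (\<lambda>_. {..n}) \<times> mon_box N M)" for n
  have "monom_of m \<in> npoly.span (G n)"
  proof (cases "m \<in> mon_box N M")
    case True
    have "monom_of m = (\<Prod>k\<in>K. f k ^ (\<lambda>k\<in>K. 0) k) * monom_of m" by simp
    with True show ?thesis unfolding G_def
      by (intro npoly.span_base image_eqI[of _ _ "(\<lambda>k\<in>K. 0, m)"]) auto
  next
    case False
    then obtain i where i: "Poly_Mapping.lookup m i > M"
      using less.prems(1) by (auto simp: mon_box_def not_le)
    have iN: "i \<le> N"
      using i less.prems(1) by (auto simp: mons_def in_keys_iff subset_iff)
    define m' where "m' = m - Poly_Mapping.single i M"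
    have m_eq: "m = Poly_Mapping.single i M + m'"
      using i by (intro poly_mapping_eqI) (auto simp: m'_def lookup_add lookup_minus lookup_single when_def)
    have m': "m' \<in> mons N"
      using less.prems(1) by (auto simp: mons_def m'_def in_keys_iff lookup_minus subset_iff)
    have deg: "mon_degree N m = M + mon_degree N m'"
      by (subst m_eq) (simp add: mon_degree_single iN)
    have "Poly_Mapping.lookup m i \<le> mon_degree N m"
      unfolding mon_degree_def using iN by (intro member_le_sum) auto
    with i less.prems(2) have n: "n > 0" by simp
    obtain r where r: "homogeneous_part N M (Var i ^ M) = (\<Sum>k\<in>K. f k * r k)" "\<And>k. k \<in> K \<Longrightarrow> r k \<in> polys N"
        "\<And>k m. k \<in> K \<Longrightarrow> m \<in> Poly_Mapping.keys (r k) \<Longrightarrow> mon_degree N m + e k = M"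
      using homogeneous_part_ideal_gen[where e = e, OF f M[OF iN]] by metis
    have "homogeneous_part N M (Var i ^ M) = Var i ^ M"
      using is_form_Var_power[OF iN, of M] by (intro homogeneous_part_eq_self) (auto simp: is_form_def)
    then have "monom_of m = (\<Sum>k\<in>K. f k * r k) * monom_of m'"
      by (subst m_eq) (simp add: r(1)[symmetric] Var_power mult_single)
    also have "\<dots> = (\<Sum>k\<in>K. f k * (r k * monom_of m'))"
      by (simp add: sum_distrib_right mult.assoc)
    also have "\<dots> \<in> npoly.span (G n)"
    proof (rule npoly.span_sum)
      fix k assume k: "k \<in> K"
      have "r k * monom_of m' \<in> npoly.span (G (n - 1))"
      proof (subst npoly_expand, intro npoly.span_sum npoly.span_scale)
        fix a assume "a \<in> Poly_Mapping.keys (r k * monom_of m')"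
        then obtain b where b: "a = b + m'" "b \<in> Poly_Mapping.keys (r k)"
          using keys_mult[of "r k" "monom_of m'"] by auto
        then have "a \<in> mons N"
          using r(2)[OF k] m' by (auto simp: polys_def intro!: mons_add)
        moreover have "mon_degree N a \<le> n - 1"
          using r(3)[OF k b(2)] e[OF k] less.prems(2) b(1) deg by simp
        ultimately show "monom_of a \<in> npoly.span (G (n - 1))"
          using less.IH[of "n - 1" a] n by (simp add: G_def)
      qed
      moreover have "npoly.span (G (n - 1)) \<subseteq> {p. f k * p \<in> npoly.span (G n)}"
      proof (rule npoly.span_minimal)
        show "G (n - 1) \<subseteq> {p. f k * p \<in> npoly.span (G n)}"
        proof
          fix p assume "p \<in> G (n - 1)"
          then obtain \<alpha> b where \<alpha>: "\<alpha> \<in> PiE K (\<lambda>_. {..n - 1})" "b \<in> mon_box N M"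
              "p = (\<Prod>k\<in>K. f k ^ \<alpha> k) * monom_of b"
            unfolding G_def by auto
          have "(\<Prod>j\<in>K. f j ^ (\<alpha>(k := Suc (\<alpha> k))) j) = f k * (\<Prod>j\<in>K. f j ^ \<alpha> j)"
            using K k by (simp add: prod.remove[of K k] mult.assoc)
          then have "f k * p = (\<Prod>j\<in>K. f j ^ (\<alpha>(k := Suc (\<alpha> k))) j) * monom_of b"
            by (simp add: \<alpha>(3) mult.assoc)
          moreover have "\<alpha>(k := Suc (\<alpha> k)) \<in> PiE K (\<lambda>_. {..n})"
          proof (rule PiE_I)
            fix j assume j: "j \<in> K"
            have "\<alpha> j \<le> n - 1" using PiE_mem[OF \<alpha>(1) j] by simp
            then show "(\<alpha>(k := Suc (\<alpha> k))) j \<in> {..n}" using n by auto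
          next
            fix j assume "j \<notin> K"
            then show "(\<alpha>(k := Suc (\<alpha> k))) j = undefined" using PiE_arb[OF \<alpha>(1)] k by auto
          qed
          ultimately have "f k * p \<in> G n"
            unfolding G_def using \<alpha>(2) by (intro image_eqI[of _ _ "(\<alpha>(k := Suc (\<alpha> k)), b)"]) auto
          then show "p \<in> {p. f k * p \<in> npoly.span (G n)}" by (simp add: npoly.span_base)
        qed
        show "npoly.subspace {p. f k * p \<in> npoly.span (G n)}"
        proof (rule npoly.subspaceI)
          fix c x assume "x \<in> {p. f k * p \<in> npoly.span (G n)}"
          then have "Const c * (f k * x) \<in> npoly.span (G n)" by (intro npoly.span_scale) auto
          then show "Const c * x \<in> {p. f k * p \<in> npoly.span (G n)}" by (simp add: mult_ac)
        qed (auto simp: npoly.span_zero distrib_left intro: npoly.span_add)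
      qed
      ultimately show "f k * (r k * monom_of m') \<in> npoly.span (G n)" by blast
    qed
    finally show ?thesis .
  qed
  then show ?case by (simp only: G_def)
qed

text \<open>
  Fewer forms of positive degree than variables have a nontrivial common zero, which is expressed by
  congruences as in \<open>weak_Nullstellensatz\<close>. If there is a proper specialisation with \<open>x\<^sub>i = 1\<close> for some \<open>i\<close>,
  it gives the zero. Otherwise \<open>monomials_spanned\<close> applies, and up to degree of order \<open>t\<close> the
  \<open>(t + 1) ^ (N + 1)\<close> monomials of a box are spanned by only \<open>O(t ^ N)\<close> products of powers of at most \<open>N\<close>
  forms with a fixed finite set of monomials, which is impossible for large \<open>t\<close>.
\<close>

lemma forms_have_common_zero:
  assumes K: "finite K" "card K \<le> N"
    and f: "\<And>k. k \<in> K \<Longrightarrow> is_form N (e k) (f k)" and e: "\<And>k. k \<in> K \<Longrightarrow> e k > 0"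
  shows "\<exists>c J. is_ideal N J \<and> 1 \<notin> J \<and> (\<forall>k\<in>K. f k \<in> J) \<and> (\<forall>i\<le>N. Var i - Const (c i) \<in> J) \<and>
           (\<exists>i\<le>N. c i \<noteq> 0)"
proof (cases "\<exists>i\<le>N. 1 \<notin> adjoin N (ideal_gen N K f) (Var i - 1)")
  case True
  then obtain i where i: "i \<le> N" "1 \<notin> adjoin N (ideal_gen N K f) (Var i - 1)" by blast
  then obtain c J where J: "is_ideal N J" "1 \<notin> J" "adjoin N (ideal_gen N K f) (Var i - 1) \<subseteq> J"
      "\<forall>i\<le>N. Var i - Const (c i) \<in> J"
    using weak_Nullstellensatz[OF is_ideal_adjoin[OF is_ideal_gen] i(2)] by blast
  have "Var i - 1 \<in> J" using generator_in_adjoin[OF is_ideal_gen] J(3) by blast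
  moreover have "Var i - Const (c i) \<in> J" using J(4) i(1) by blast
  ultimately have "(Var i - 1) - (Var i - Const (c i)) \<in> J" by (rule ideal_diff[OF J(1)])
  also have "(Var i - 1) - (Var i - Const (c i)) = Const (c i - 1)" by (simp add: Const_diff)
  finally have "c i = 1" using proper_ideal_no_Const[OF J(1,2)] by fastforce
  moreover have "\<forall>k\<in>K. f k \<in> J"
    using generator_in_ideal_gen[OF K(1)] subset_adjoin J(3) by blast
  ultimately show ?thesis using J i(1) by (intro exI[of _ c] exI[of _ J]) auto
next
  case False
  then have "\<forall>i\<in>{..N}. \<exists>n. Var i ^ n \<in> ideal_gen N K f"
    using Var_power_in_ideal[where e = e, OF f] by auto
  then obtain n where n: "\<And>i. i \<le> N \<Longrightarrow> Var i ^ n i \<in> ideal_gen N K f" by (metis atMost_iff)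
  define M where "M = (\<Sum>i\<le>N. n i)"
  have M: "Var i ^ M \<in> ideal_gen N K f" if "i \<le> N" for i
  proof -
    have "n i \<le> M" unfolding M_def using that by (intro member_le_sum) auto
    then have "Var i ^ M = Var i ^ (M - n i) * Var i ^ n i" by (simp flip: power_add)
    moreover have "\<dots> \<in> ideal_gen N K f"
      by (intro ideal_mult[OF is_ideal_gen] polys_power polys_Var that n)
    ultimately show ?thesis by (simp only:)
  qed
  \<comment> \<open>A value of \<open>t\<close> that makes \<open>((N + 1) * (t + 1)) ^ N * (M + 1) ^ (N + 1) < (t + 1) ^ (N + 1)\<close>; monomials in the box of size \<open>t\<close> have degree at most \<open>D\<close>.\<close>
  define t where "t = (N + 1) ^ N * (M + 1) ^ (N + 1)"
  define D where "D = (N + 1) * t"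
  define G where "G = (\<lambda>(\<alpha>, m). (\<Prod>k\<in>K. f k ^ \<alpha> k) * monom_of m) `
           (PiE K (\<lambda>_. {..D}) \<times> mon_box N M)"
  have fin: "finite (PiE K (\<lambda>_. {..D}) \<times> mon_box N M)"
    by (intro finite_cartesian_product finite_PiE finite_mon_box K) auto
  have "monom_of ` mon_box N t \<subseteq> npoly.span G"
  proof (intro image_subsetI)
    fix m assume m: "m \<in> mon_box N t"
    have "mon_degree N m \<le> (\<Sum>i\<le>N. t)"
      unfolding mon_degree_def using m by (intro sum_mono) (auto simp: mon_box_def)
    then have "mon_degree N m \<le> D" by (simp add: D_def)
    with m show "monom_of m \<in> npoly.span G" unfolding G_def
      by (intro monomials_spanned[where e = e, OF K(1) f e M]) (auto simp: mon_box_def)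
  qed
  moreover have "finite G" unfolding G_def by (intro finite_imageI fin)
  ultimately have "card (monom_of ` mon_box N t) \<le> card G"
    using npoly.independent_span_bound[OF _ independent_monomials] by simp
  also have "card (monom_of ` mon_box N t) = (t + 1) ^ (N + 1)"
  proof (subst card_image)
    show "inj_on monom_of (mon_box N t)"
      by (rule inj_onI, drule arg_cong[of _ _ Poly_Mapping.keys]) simp
  qed (simp add: card_mon_box)
  also have "card G \<le> card (PiE K (\<lambda>_. {..D}) \<times> mon_box N M)"
    unfolding G_def by (rule card_image_le[OF fin])
  also have "\<dots> = (D + 1) ^ card K * (M + 1) ^ (N + 1)"
    using K(1) by (simp add: card_cartesian_product card_PiE card_mon_box)
  also have "\<dots> \<le> ((N + 1) * (t + 1)) ^ N * (M + 1) ^ (N + 1)"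
  proof (intro mult_right_mono)
    have "(D + 1) ^ card K \<le> (D + 1) ^ N" by (intro power_increasing K) simp
    also have "\<dots> \<le> ((N + 1) * (t + 1)) ^ N" by (intro power_mono) (simp_all add: D_def)
    finally show "(D + 1) ^ card K \<le> ((N + 1) * (t + 1)) ^ N" .
  qed simp
  also have "\<dots> = ((N + 1) ^ N * (M + 1) ^ (N + 1)) * (t + 1) ^ N"
    by (simp only: power_mult_distrib mult_ac)
  also have "\<dots> = t * (t + 1) ^ N" by (simp only: t_def)
  finally have "(t + 1) * (t + 1) ^ N \<le> t * (t + 1) ^ N" by simp
  then show ?thesis by simp
qed

section \<open>Weighted power sums\<close>

lemma is_form_diff: "is_form N n p \<Longrightarrow> is_form N n q \<Longrightarrow> is_form N n (p - q)"
  using keys_diff[of p q] by (auto simp: is_form_def polys_diff)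

lemma is_form_sum: "(\<And>i. i \<in> A \<Longrightarrow> is_form N n (f i)) \<Longrightarrow> is_form N n (sum f A)"
  using keys_sum[of f A] by (fastforce simp: is_form_def intro: polys_sum)

lemma is_form_Const_mult: "is_form N n p \<Longrightarrow> is_form N n (Const c * p)"
  using keys_mult[of "Const c" p] by (auto simp: is_form_def polys_mult polys_Const split: if_splits)

lemma ideal_cong_power:
  assumes J: "is_ideal N J" and x: "x \<in> polys N" "x - Const c \<in> J"
  shows "x ^ k - Const (c ^ k) \<in> J"
proof (induction k)
  case 0
  then show ?case by (simp add: ideal_zero[OF J])
next
  case (Suc k)
  have "x * (x ^ k - Const (c ^ k)) + Const (c ^ k) * (x - Const c) \<in> J"
    by (intro ideal_add[OF J] ideal_mult[OF J] Suc x polys_Const)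
  also have "x * (x ^ k - Const (c ^ k)) + Const (c ^ k) * (x - Const c) = x ^ Suc k - Const (c ^ Suc k)"
    by (simp add: algebra_simps Const_mult)
  finally show ?case .
qed

text \<open>
  Collecting equal values \<open>x i\<close> turns the hypothesis into a linear relation between the powers of the
  distinct nonzero values, with coefficients that are subset sums of \<open>l\<close> and hence nonzero. There are at most
  \<open>card A\<close> of these values, so a polynomial of degree at most \<open>card A\<close> without constant term can single
  out one of them, which contradicts the relation.
\<close>

lemma weighted_power_sums_zero:
  fixes l x :: "'i \<Rightarrow> complex"
  assumes A: "finite A" and l: "\<And>I. I \<subseteq> A \<Longrightarrow> I \<noteq> {} \<Longrightarrow> sum l I \<noteq> 0"
    and zero: "\<And>k. 1 \<le> k \<Longrightarrow> k \<le> card A \<Longrightarrow> (\<Sum>i\<in>A. l i * x i ^ k) = 0"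
    and i: "i \<in> A"
  shows "x i = 0"
proof (rule ccontr)
  assume ne: "x i \<noteq> 0"
  define Y where "Y = x ` A - {0, x i}"
  define p where "p = [:0, 1:] * (\<Prod>y\<in>Y. [:- y, 1:])"
  have Y: "finite Y" "card Y < card A"
  proof -
    show "finite Y" using A by (simp add: Y_def)
    have "Y \<subset> x ` A" using i by (auto simp: Y_def)
    then have "card Y < card (x ` A)" using A by (intro psubset_card_mono) auto
    then show "card Y < card A" using card_image_le[OF A, of x] by simp
  qed
  have "degree p \<le> degree [:0, 1 :: complex:] + degree (\<Prod>y\<in>Y. [:- y, 1:])"
    unfolding p_def by (rule degree_mult_le)
  also have "degree (\<Prod>y\<in>Y. [:- y, 1:]) \<le> (\<Sum>y\<in>Y. degree [:- y, 1:])"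
    using degree_prod_sum_le[OF Y(1), of "\<lambda>y. [:- y, 1:]"] by (simp add: o_def)
  also have "degree [:0, 1 :: complex:] + (\<Sum>y\<in>Y. degree [:- y, 1:]) \<le> card A" using Y(2) by simp
  finally have deg: "degree p \<le> card A" by simp
  have c0: "coeff p 0 = 0" by (simp add: p_def)
  have "(\<Sum>j\<in>A. l j * poly p (x j)) = (\<Sum>k\<le>degree p. coeff p k * (\<Sum>j\<in>A. l j * x j ^ k))"
    unfolding poly_altdef sum_distrib_left by (subst sum.swap) (simp add: mult_ac)
  also have "\<dots> = 0"
  proof (intro sum.neutral ballI)
    fix k assume "k \<in> {..degree p}"
    then show "coeff p k * (\<Sum>j\<in>A. l j * x j ^ k) = 0"
      using c0 zero[of k] deg by (cases "k = 0") auto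
  qed
  finally have "0 = (\<Sum>j\<in>A. l j * poly p (x j))" by simp
  also have "\<dots> = (\<Sum>j\<in>A. if x j = x i then l j * poly p (x i) else 0)"
  proof (intro sum.cong refl)
    fix j assume j: "j \<in> A"
    have "poly p (x j) = 0" if "x j \<noteq> x i"
      using that j Y(1) by (auto simp: p_def poly_prod Y_def)
    then show "l j * poly p (x j) = (if x j = x i then l j * poly p (x i) else 0)" by auto
  qed
  also have "\<dots> = (\<Sum>j\<in>{j\<in>A. x j = x i}. l j) * poly p (x i)"
    using A by (auto simp: sum.inter_filter sum_distrib_right intro!: sum.cong)
  finally have "(\<Sum>j\<in>{j\<in>A. x j = x i}. l j) * poly p (x i) = 0" by simp
  moreover have "poly p (x i) \<noteq> 0" using ne Y(1) by (auto simp: p_def poly_prod Y_def)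
  moreover have "(\<Sum>j\<in>{j\<in>A. x j = x i}. l j) \<noteq> 0" using i by (intro l) auto
  ultimately show False by simp
qed

text \<open>
  Homogenising with \<open>x\<^sub>0\<close> gives the \<open>N\<close> forms \<open>\<Sum>i. l i * x\<^sub>i ^ k - a k * x\<^sub>0 ^ k\<close> in \<open>N + 1\<close> variables,
  which have a nontrivial common zero \<open>c\<close>. A zero with \<open>c 0 = 0\<close> would annihilate all weighted power
  sums and be trivial, so that \<open>c i / c 0\<close> is a solution.
\<close>

lemma weighted_power_sums_surjective:
  fixes l a :: "nat \<Rightarrow> complex"
  assumes l: "\<And>I. I \<subseteq> {1..N} \<Longrightarrow> I \<noteq> {} \<Longrightarrow> sum l I \<noteq> 0"
  shows "\<exists>\<mu>. \<forall>k\<in>{1..N}. (\<Sum>i=1..N. l i * \<mu> i ^ k) = a k"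
proof -
  define f where "f k = (\<Sum>i=1..N. Const (l i) * Var i ^ k) - Const (a k) * Var 0 ^ k" for k
  have "is_form N k (f k)" for k
    unfolding f_def by (intro is_form_diff is_form_sum is_form_Const_mult is_form_Var_power) auto
  then obtain c J where J: "is_ideal N J" "1 \<notin> J" "\<forall>k\<in>{1..N}. f k \<in> J"
      "\<forall>i\<le>N. Var i - Const (c i) \<in> J" and c: "\<exists>i\<le>N. c i \<noteq> 0"
    using forms_have_common_zero[of "{1..N}" N "\<lambda>k. k" f] by auto
  have eq: "(\<Sum>i=1..N. l i * c i ^ k) = a k * c 0 ^ k" if k: "k \<in> {1..N}" for k
  proof -
    have pow: "Var i ^ k - Const (c i ^ k) \<in> J" if "i \<le> N" for i
      using J(4) that by (intro ideal_cong_power[OF J(1)] polys_Var) auto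
    let ?v = "(\<Sum>i=1..N. l i * c i ^ k) - a k * c 0 ^ k"
    have "(\<Sum>i=1..N. Const (l i) * (Var i ^ k - Const (c i ^ k))) \<in> J"
      by (rule ideal_sum[OF J(1)], rule ideal_mult[OF J(1) polys_Const], rule pow) simp
    moreover have "Const (a k) * (Var 0 ^ k - Const (c 0 ^ k)) \<in> J"
      by (rule ideal_mult[OF J(1) polys_Const pow]) simp
    ultimately have "f k - ((\<Sum>i=1..N. Const (l i) * (Var i ^ k - Const (c i ^ k)))
                - Const (a k) * (Var 0 ^ k - Const (c 0 ^ k))) \<in> J"
      using J(3) k by (intro ideal_diff[OF J(1)]) auto
    also have "f k - ((\<Sum>i=1..N. Const (l i) * (Var i ^ k - Const (c i ^ k)))
                - Const (a k) * (Var 0 ^ k - Const (c 0 ^ k))) = Const ?v"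
      by (simp add: f_def Const_diff Const_sum Const_mult right_diff_distrib sum_subtractf)
    finally have "?v = 0" by (rule proper_ideal_no_Const[OF J(1,2)])
    then show ?thesis by simp
  qed
  have "c 0 \<noteq> 0"
  proof
    assume c0: "c 0 = 0"
    have "c i = 0" if i: "i \<in> {1..N}" for i
    proof (rule weighted_power_sums_zero[where A = "{1..N}" and l = l])
      fix k assume "1 \<le> k" "k \<le> card {1..N}"
      then show "(\<Sum>i=1..N. l i * c i ^ k) = 0" using eq[of k] c0 by simp
    qed (use l i in auto)
    then have "c i = 0" if "i \<le> N" for i using that c0 by (cases "i = 0") auto
    with c show False by blast
  qed
  then have "(\<Sum>i=1..N. l i * (c i / c 0) ^ k) = a k" if "k \<in> {1..N}" for k
    using eq[OF that] by (simp add: power_divide flip: sum_divide_distrib)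
  then show ?thesis by (intro exI[of _ "\<lambda>i. c i / c 0"] ballI)
qed

section \<open>Restriction of a polynomial map to a line\<close>

lemma subst_mpoly_superset:
  assumes "finite K" "Poly_Mapping.keys p \<subseteq> K" "h 0 = 0"
  shows "subst_mpoly h x p = (\<Sum>m\<in>K. h (Poly_Mapping.lookup p m) * (\<Prod>i\<in>UNIV. x i ^ Poly_Mapping.lookup m i))"
  unfolding subst_mpoly_def using assms by (intro sum.mono_neutral_left) (auto simp: in_keys_iff)

lemma eval_mpoly_add: "eval_mpoly (p + q) a = eval_mpoly p a + eval_mpoly q a"
proof -
  let ?K = "Poly_Mapping.keys p \<union> Poly_Mapping.keys q"
  have "Poly_Mapping.keys (p + q) \<subseteq> ?K" by (rule keys_add)
  then show ?thesis
    by (simp add: eval_mpoly_def subst_mpoly_superset[of ?K] lookup_add distrib_right sum.distrib)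
qed

lemma eval_mpoly_sum: "eval_mpoly (sum f A) a = (\<Sum>i\<in>A. eval_mpoly (f i) a)"
proof -
  have "eval_mpoly 0 a = 0" by (simp add: eval_mpoly_def subst_mpoly_def)
  then show ?thesis
    by (induction A rule: infinite_finite_induct) (simp_all add: eval_mpoly_add)
qed

lemma eval_mpoly_single:
  "eval_mpoly (Poly_Mapping.single m c) a = c * (\<Prod>i\<in>UNIV. a $ i ^ Poly_Mapping.lookup m i)"
  by (simp add: eval_mpoly_def subst_mpoly_superset[of "{m}"])

lemma poly_line_poly: "poly (line_poly p b g) t = eval_mpoly p (b + t *s g)"
  by (simp add: line_poly_def eval_mpoly_def subst_mpoly_def poly_sum poly_prod)

lemma pderiv_sum: "pderiv (sum f A) = (\<Sum>i\<in>A. pderiv (f i))"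
  using higher_pderiv_sum[of 1 f A] by simp

lemma poly_pderiv_line_poly:
  "poly (pderiv (line_poly p b g)) t = (\<Sum>i\<in>UNIV. eval_mpoly (partial_deriv i p) (b + t *s g) * g $ i)"
proof -
  let ?a = "b + t *s g"
  have drop: "(\<Prod>j\<in>UNIV. ?a $ j ^ Poly_Mapping.lookup (m - Poly_Mapping.single i 1) j) =
      (\<Prod>j\<in>UNIV - {i}. ?a $ j ^ Poly_Mapping.lookup m j) * ?a $ i ^ (Poly_Mapping.lookup m i - 1)" for m i
  proof -
    have "(\<Prod>j\<in>UNIV - {i}. ?a $ j ^ Poly_Mapping.lookup (m - Poly_Mapping.single i 1) j) =
        (\<Prod>j\<in>UNIV - {i}. ?a $ j ^ Poly_Mapping.lookup m j)"
      by (intro prod.cong refl) (simp add: lookup_minus lookup_single when_def)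
    then show ?thesis
      by (subst prod.remove[of UNIV i]) (simp_all add: lookup_minus mult.commute)
  qed
  have "poly (pderiv (line_poly p b g)) t = (\<Sum>m\<in>Poly_Mapping.keys p. Poly_Mapping.lookup p m *
      (\<Sum>i\<in>UNIV. (\<Prod>j\<in>UNIV - {i}. ?a $ j ^ Poly_Mapping.lookup m j) *
         (of_nat (Poly_Mapping.lookup m i) * ?a $ i ^ (Poly_Mapping.lookup m i - 1) * g $ i)))"
    by (simp add: line_poly_def subst_mpoly_def pderiv_sum pderiv_smult pderiv_prod pderiv_power pderiv_pCons
        poly_sum poly_prod mult_ac)
  also have "\<dots> = (\<Sum>m\<in>Poly_Mapping.keys p. \<Sum>i\<in>UNIV.
      of_nat (Poly_Mapping.lookup m i) * Poly_Mapping.lookup p m *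
      (\<Prod>j\<in>UNIV. ?a $ j ^ Poly_Mapping.lookup (m - Poly_Mapping.single i 1) j) * g $ i)"
    unfolding drop sum_distrib_left by (intro sum.cong refl) (simp add: mult_ac)
  also have "\<dots> = (\<Sum>i\<in>UNIV. eval_mpoly (partial_deriv i p) ?a * g $ i)"
    by (subst sum.swap)
       (simp add: partial_deriv_def eval_mpoly_sum eval_mpoly_single sum_distrib_right)
  finally show ?thesis .
qed

text \<open>
  The chain rule turns the hypotheses on the Jacobian into statements about the univariate polynomials
  \<open>d/dT F\<^sub>j(b + T g)\<close>.
\<close>

lemma jacobian_times_direction:
  "(eval_matrix (jacobian_matrix F) (b + t *s g) *v g) $ j = poly (pderiv (line_poly (F $ j) b g)) t"
  by (simp add: matrix_vector_mult_def eval_matrix_def jacobian_matrix_def poly_pderiv_line_poly)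

lemma degree_line_poly_le: "degree (line_poly p b g) \<le> total_degree p"
  unfolding line_poly_def subst_mpoly_def
proof (rule degree_sum_le)
  fix m assume m: "m \<in> Poly_Mapping.keys p"
  have "degree ([:Poly_Mapping.lookup p m:] * (\<Prod>i\<in>UNIV. [:b $ i, g $ i:] ^ Poly_Mapping.lookup m i))
      \<le> degree (\<Prod>i\<in>UNIV. [:b $ i, g $ i:] ^ Poly_Mapping.lookup m i)"
    by simp
  also have "\<dots> \<le> (\<Sum>i\<in>UNIV. degree ([:b $ i, g $ i:] ^ Poly_Mapping.lookup m i))"
    using degree_prod_sum_le[of UNIV "\<lambda>i. [:b $ i, g $ i:] ^ Poly_Mapping.lookup m i"] by (simp add: o_def)
  also have "\<dots> \<le> (\<Sum>i\<in>UNIV. Poly_Mapping.lookup m i)"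
  proof (rule sum_mono)
    fix i
    have "degree ([:b $ i, g $ i:] ^ Poly_Mapping.lookup m i) \<le> degree [:b $ i, g $ i:] * Poly_Mapping.lookup m i"
      by (rule degree_power_le)
    also have "\<dots> \<le> 1 * Poly_Mapping.lookup m i" by (intro mult_right_mono) auto
    finally show "degree ([:b $ i, g $ i:] ^ Poly_Mapping.lookup m i) \<le> Poly_Mapping.lookup m i" by simp
  qed
  also have "\<dots> \<le> total_degree p"
    unfolding total_degree_def using m by (intro Max_ge) auto
  finally show "degree ([:Poly_Mapping.lookup p m:] * (\<Prod>i\<in>UNIV. [:b $ i, g $ i:] ^ Poly_Mapping.lookup m i))
      \<le> total_degree p" .
qed simp

text \<open>
  Extend a basis of the span of \<open>S\<close> by \<open>x\<close>; the functional is a row of the matrix of a linear map that kills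
  the basis and sends \<open>x\<close> to the all-ones vector.
\<close>

lemma separating_functional:
  fixes x :: "complex ^ 'm::finite"
  assumes "x \<notin> vec.span S"
  shows "\<exists>v :: complex ^ 'm. (\<Sum>j\<in>UNIV. v $ j * x $ j) = 1 \<and> (\<forall>y\<in>S. (\<Sum>j\<in>UNIV. v $ j * y $ j) = 0)"
proof -
  obtain B where B: "B \<subseteq> S" "vec.independent B" "S \<subseteq> vec.span B"
    using vec.maximal_independent_subset[of S] by blast
  have x: "x \<notin> vec.span B" using assms vec.span_mono[OF B(1)] by blast
  then have "vec.independent (insert x B)" using B(2) by (simp add: vec.independent_insert)
  then obtain h where h: "Vector_Spaces.linear (*s) (*s) h"
      "\<forall>y\<in>insert x B. h y = (if y = x then 1 else 0 :: complex ^ 'm)"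
    using vec.linear_independent_extend[of "insert x B" "\<lambda>y. if y = x then 1 else 0"] by blast
  have hB: "h y = 0" if "y \<in> B" for y
    using h(2) that x vec.span_base[of y B] by auto
  have h0: "h y = 0" if "y \<in> S" for y
    using vec.linear_eq_0_on_span[OF h(1), of B y] hB B(3) that by blast
  have hm: "h y $ i = (\<Sum>j\<in>UNIV. matrix h $ i $ j * y $ j)" for y i
    by (subst matrix_works[OF h(1), symmetric]) (simp add: matrix_vector_mult_def)
  \<comment> \<open>All rows do the job, because every coordinate of \<open>h x = 1\<close> is 1.\<close>
  let ?v = "matrix h $ undefined"
  have "(\<Sum>j\<in>UNIV. ?v $ j * x $ j) = 1" using h(2) by (simp flip: hm)
  moreover have "\<forall>y\<in>S. (\<Sum>j\<in>UNIV. ?v $ j * y $ j) = 0" using h0 by (simp flip: hm)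
  ultimately show ?thesis by blast
qed

lemma in_span_image_finite:
  fixes f :: "'k \<Rightarrow> complex ^ 'm::finite"
  assumes "finite K" "x \<in> vec.span (f ` K)"
  shows "\<exists>u. x = (\<Sum>k\<in>K. u k *s f k)"
proof -
  have "vec.span (f ` K) \<subseteq> {x. \<exists>u. x = (\<Sum>k\<in>K. u k *s f k)}"
  proof (rule vec.span_minimal)
    show "f ` K \<subseteq> {x. \<exists>u. x = (\<Sum>k\<in>K. u k *s f k)}"
    proof (intro image_subsetI CollectI exI)
      fix k assume "k \<in> K"
      have "(\<Sum>j\<in>K. (if j = k then 1 else 0) *s f j) = (\<Sum>j\<in>K. if j = k then f j else 0)"
        by (intro sum.cong) auto
      with \<open>k \<in> K\<close> assms(1) show "f k = (\<Sum>j\<in>K. (if j = k then 1 else 0) *s f j)" by simp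
    qed
    show "vec.subspace {x. \<exists>u. x = (\<Sum>k\<in>K. u k *s f k)}"
    proof (rule vec.subspaceI)
      show "0 \<in> {x. \<exists>u. x = (\<Sum>k\<in>K. u k *s f k)}" by (auto intro!: exI[of _ "\<lambda>_. 0"])
    next
      fix x y assume "x \<in> {x. \<exists>u. x = (\<Sum>k\<in>K. u k *s f k)}" "y \<in> {x. \<exists>u. x = (\<Sum>k\<in>K. u k *s f k)}"
      then obtain u w where "x = (\<Sum>k\<in>K. u k *s f k)" "y = (\<Sum>k\<in>K. w k *s f k)" by blast
      then show "x + y \<in> {x. \<exists>u. x = (\<Sum>k\<in>K. u k *s f k)}"
        by (auto intro!: exI[of _ "\<lambda>k. u k + w k"] simp: vec.scale_left_distrib sum.distrib)
    next
      fix c x assume "x \<in> {x. \<exists>u. x = (\<Sum>k\<in>K. u k *s f k)}"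
      then obtain u where "x = (\<Sum>k\<in>K. u k *s f k)" by blast
      then show "c *s x \<in> {x. \<exists>u. x = (\<Sum>k\<in>K. u k *s f k)}"
        by (auto intro!: exI[of _ "\<lambda>k. c * u k"] simp: vec.scale_sum_right)
    qed
  qed
  with assms(2) show ?thesis by blast
qed

section \<open>The equivalence\<close>

theorem theorem2p6:
  fixes d :: nat
    and F :: "('n::finite, 'm::finite) polymap"
    and \<beta> \<gamma> :: "complex ^ 'n"
  assumes "d \<ge> 2" and "map_degree F \<le> d"
  shows
    "((\<exists>l :: nat \<Rightarrow> complex.
          (\<forall>I. I \<subseteq> {1..d-1} \<and> I \<noteq> {} \<longrightarrow> (\<Sum>i\<in>I. l i) \<noteq> 0) \<and>
          (\<forall>\<alpha> :: nat \<Rightarrow> complex ^ 'n. (\<forall>i\<in>{1..d-1}. \<alpha> i \<in> line \<beta> \<gamma>) \<longrightarrow>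
             (\<Sum>i=1..d-1. l i *s (eval_matrix (jacobian_matrix F) (\<alpha> i) *v \<gamma>)) \<noteq> 0))
        \<longleftrightarrow> linearly_rectifiable_on_line F \<beta> \<gamma>)
     \<and> (linearly_rectifiable_on_line F \<beta> \<gamma> \<longleftrightarrow>
        (\<forall>(s :: nat) (l :: nat \<Rightarrow> complex) (\<alpha> :: nat \<Rightarrow> complex ^ 'n).
           (\<Sum>i=1..s. l i) \<noteq> 0 \<and> (\<forall>i\<in>{1..s}. \<alpha> i \<in> line \<beta> \<gamma>) \<longrightarrow>
             (\<Sum>i=1..s. l i *s (eval_matrix (jacobian_matrix F) (\<alpha> i) *v \<gamma>)) \<noteq> 0))
     \<and> (linearly_rectifiable_on_line F \<beta> \<gamma> \<longrightarrow> inj_on (eval_map F) (line \<beta> \<gamma>))"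
    (is "(?one \<longleftrightarrow> ?two) \<and> (?two \<longleftrightarrow> ?three) \<and> (?two \<longrightarrow> ?inj)")
proof -
  define N where "N = d - 1"
  define p where "p j = line_poly (F $ j) \<beta> \<gamma>" for j
  define q where "q j = pderiv (p j)" for j
  let ?G = "\<lambda>a. eval_matrix (jacobian_matrix F) a *v \<gamma>"
  have G: "?G (\<beta> + t *s \<gamma>) $ j = poly (q j) t" for t j
    by (simp add: jacobian_times_direction q_def p_def)
  have deg: "degree (q j) \<le> N" for j
  proof -
    have "degree (p j) \<le> total_degree (F $ j)" unfolding p_def by (rule degree_line_poly_le)
    also have "\<dots> \<le> map_degree F" unfolding map_degree_def by (intro Max_ge) auto
    finally show ?thesis using assms(2) by (simp add: q_def degree_pderiv N_def)
  qed
  have two_iff: "?two \<longleftrightarrow> (\<exists>v :: complex ^ 'm. (\<Sum>j\<in>UNIV. smult (v $ j) (q j)) = 1)"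
    by (simp add: linearly_rectifiable_on_line_def q_def p_def)

  have one_two: ?two if ?one
  proof (rule ccontr)
    assume not_two: "\<not> ?two"
    from \<open>?one\<close> obtain l where
        l: "\<forall>I. I \<subseteq> {1..N} \<and> I \<noteq> {} \<longrightarrow> sum l I \<noteq> 0"
      and nz: "\<forall>\<alpha>. (\<forall>i\<in>{1..N}. \<alpha> i \<in> line \<beta> \<gamma>) \<longrightarrow> (\<Sum>i=1..N. l i *s ?G (\<alpha> i)) \<noteq> 0"
      by (elim exE conjE) (rule that[unfolded N_def])
    \<comment> \<open>The derivative along the line is \<open>\<Sum>k\<le>N. T ^ k *s c k\<close>, and a rectifying \<open>v\<close> is a functional with value 1 on \<open>c 0\<close> that kills the other \<open>c k\<close>.\<close>
    define c where "c k = (\<chi> j. coeff (q j) k)" for k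
    have "c 0 \<in> vec.span (c ` {1..N})"
    proof (rule ccontr)
      assume "c 0 \<notin> vec.span (c ` {1..N})"
      from separating_functional[OF this] obtain v :: "complex ^ 'm" where
        v: "(\<Sum>j\<in>UNIV. v $ j * c 0 $ j) = 1" "\<forall>y\<in>c ` {1..N}. (\<Sum>j\<in>UNIV. v $ j * y $ j) = 0"
        by blast
      have "(\<Sum>j\<in>UNIV. smult (v $ j) (q j)) = 1"
      proof (rule poly_eqI)
        fix k
        have *: "coeff (\<Sum>j\<in>UNIV. smult (v $ j) (q j)) k = (\<Sum>j\<in>UNIV. v $ j * c k $ j)"
          by (simp add: coeff_sum c_def)
        consider "k = 0" | "k \<in> {1..N}" | "k > N" by fastforce
        then show "coeff (\<Sum>j\<in>UNIV. smult (v $ j) (q j)) k = coeff 1 k"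
        proof cases
          case 3
          then have "c k $ j = 0" for j
            using deg[of j] by (simp add: c_def coeff_eq_0)
          with * 3 show ?thesis by simp
        qed (use * v in auto)
      qed
      with not_two two_iff show False by blast
    qed
    then obtain u where u: "c 0 = (\<Sum>k=1..N. u k *s c k)"
      using in_span_image_finite[of "{1..N}" _ c] by blast
    \<comment> \<open>Points with weighted power sums \<open>- L * u k\<close> make the constant terms, which contribute \<open>L *s c 0\<close>, cancel against the rest.\<close>
    define L where "L = (\<Sum>i=1..N. l i)"
    have "\<exists>\<mu>. \<forall>k\<in>{1..N}. (\<Sum>i=1..N. l i * \<mu> i ^ k) = - L * u k"
    proof (rule weighted_power_sums_surjective)
      fix I assume "I \<subseteq> {1..N}" "I \<noteq> {}"
      then show "sum l I \<noteq> 0" using l by blast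
    qed
    then obtain \<mu> where \<mu>: "\<forall>k\<in>{1..N}. (\<Sum>i=1..N. l i * \<mu> i ^ k) = - L * u k" ..
    have "(\<Sum>i=1..N. l i *s ?G (\<beta> + \<mu> i *s \<gamma>)) $ j = 0" for j
    proof -
      have "(\<Sum>i=1..N. l i *s ?G (\<beta> + \<mu> i *s \<gamma>)) $ j = (\<Sum>i=1..N. l i * poly (q j) (\<mu> i))"
        by (simp add: G)
      also have "\<dots> = (\<Sum>i=1..N. l i * (\<Sum>k\<le>N. c k $ j * \<mu> i ^ k))"
      proof -
        have "poly (q j) x = (\<Sum>k\<le>N. coeff (q j) k * x ^ k)" for x
          unfolding poly_altdef using deg[of j]
          by (intro sum.mono_neutral_left) (auto simp: coeff_eq_0)
        then show ?thesis by (simp add: c_def)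
      qed
      also have "\<dots> = (\<Sum>k\<le>N. c k $ j * (\<Sum>i=1..N. l i * \<mu> i ^ k))"
        unfolding sum_distrib_left by (subst sum.swap) (simp add: mult_ac)
      also have "\<dots> = c 0 $ j * L + (\<Sum>k=1..N. c k $ j * (\<Sum>i=1..N. l i * \<mu> i ^ k))"
        by (simp add: L_def atMost_atLeast0 sum.atLeast_Suc_atMost)
      also have "(\<Sum>k=1..N. c k $ j * (\<Sum>i=1..N. l i * \<mu> i ^ k)) = (\<Sum>k=1..N. c k $ j * (- L * u k))"
        by (intro sum.cong refl) (simp only: bspec[OF \<mu>])
      also have "\<dots> = - L * (\<Sum>k=1..N. u k *s c k) $ j"
        by (simp add: sum_distrib_left mult_ac sum_negf)
      also have "(\<Sum>k=1..N. u k *s c k) = c 0" by (rule u[symmetric])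
      finally show ?thesis by (simp only: mult.commute[of _ L] mult_minus_left add.right_inverse)
    qed
    then have "(\<Sum>i=1..N. l i *s ?G (\<beta> + \<mu> i *s \<gamma>)) = 0" by (simp add: vec_eq_iff)
    moreover have "\<forall>i\<in>{1..N}. \<beta> + \<mu> i *s \<gamma> \<in> line \<beta> \<gamma>" by (auto simp: line_def)
    ultimately show False using nz[THEN spec, of "\<lambda>i. \<beta> + \<mu> i *s \<gamma>"] by blast
  qed

  \<comment> \<open>Pairing with \<open>v\<close> turns the weighted sum of derivatives into \<open>\<Sum>i. l i\<close>.\<close>
  have two_three: ?three if ?two
  proof (intro allI impI notI)
    fix s :: nat and l :: "nat \<Rightarrow> complex" and \<alpha> :: "nat \<Rightarrow> complex ^ 'n"
    assume a: "(\<Sum>i=1..s. l i) \<noteq> 0 \<and> (\<forall>i\<in>{1..s}. \<alpha> i \<in> line \<beta> \<gamma>)"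
      and zero: "(\<Sum>i=1..s. l i *s ?G (\<alpha> i)) = 0"
    obtain v :: "complex ^ 'm" where v: "(\<Sum>j\<in>UNIV. smult (v $ j) (q j)) = 1"
      using \<open>?two\<close> two_iff by blast
    have vG: "(\<Sum>j\<in>UNIV. v $ j * ?G (\<alpha> i) $ j) = 1" if i: "i \<in> {1..s}" for i
    proof -
      have "\<alpha> i \<in> line \<beta> \<gamma>" using a i by blast
      then obtain t where "\<alpha> i = \<beta> + t *s \<gamma>" unfolding line_def by blast
      then have "(\<Sum>j\<in>UNIV. v $ j * ?G (\<alpha> i) $ j) = poly (\<Sum>j\<in>UNIV. smult (v $ j) (q j)) t"
        by (simp add: G poly_sum)
      then show ?thesis by (simp add: v)
    qed
    have "0 = (\<Sum>j\<in>UNIV. v $ j * (\<Sum>i=1..s. l i *s ?G (\<alpha> i)) $ j)" unfolding zero by simp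
    also have "\<dots> = (\<Sum>i=1..s. l i * (\<Sum>j\<in>UNIV. v $ j * ?G (\<alpha> i) $ j))"
      by (simp add: sum_distrib_left mult_ac) (rule sum.swap)
    also have "\<dots> = (\<Sum>i=1..s. l i)" using vG by simp
    finally show False using a by simp
  qed

  have three_one: ?one if ?three
  proof (intro exI[of _ "\<lambda>_. 1"] conjI allI impI)
    fix I :: "nat set" assume I: "I \<subseteq> {1..d-1} \<and> I \<noteq> {}"
    then have "finite I" by (auto intro: finite_subset)
    with I show "(\<Sum>i\<in>I. 1 :: complex) \<noteq> 0" by simp
  next
    fix \<alpha> :: "nat \<Rightarrow> complex ^ 'n" assume "\<forall>i\<in>{1..d-1}. \<alpha> i \<in> line \<beta> \<gamma>"
    moreover have "(\<Sum>i=1..d-1. 1 :: complex) \<noteq> 0" using assms(1) by simp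
    ultimately show "(\<Sum>i=1..d-1. 1 *s ?G (\<alpha> i)) \<noteq> 0"
      using \<open>?three\<close>[rule_format, of "\<lambda>_. 1" "d - 1" \<alpha>] by blast
  qed

  have two_inj: ?inj if ?two
  proof (rule inj_onI)
    fix x y assume "x \<in> line \<beta> \<gamma>" "y \<in> line \<beta> \<gamma>" and eq: "eval_map F x = eval_map F y"
    then obtain t t' where x: "x = \<beta> + t *s \<gamma>" and y: "y = \<beta> + t' *s \<gamma>"
      unfolding line_def by blast
    obtain v :: "complex ^ 'm" where v: "(\<Sum>j\<in>UNIV. smult (v $ j) (q j)) = 1"
      using \<open>?two\<close> two_iff by blast
    define P where "P = (\<Sum>j\<in>UNIV. smult (v $ j) (p j))"
    have "pderiv (P - [:0, 1:]) = 0"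
      using v by (simp add: P_def pderiv_diff pderiv_sum pderiv_smult pderiv_pCons q_def flip: pCons_one)
    then obtain a where "P - [:0, 1:] = [:a:]"
      by (metis pderiv_eq_0_iff degree_eq_zeroE)
    then have "P = [:a:] + [:0, 1:]" by (metis diff_add_cancel)
    then have P: "poly P s = a + s" for s by simp
    have Pe: "poly P s = (\<Sum>j\<in>UNIV. v $ j * eval_map F (\<beta> + s *s \<gamma>) $ j)" for s
      by (simp add: P_def p_def poly_sum poly_line_poly eval_map_def)
    have "a + t = a + t'" using eq by (simp only: x y flip: P Pe) (simp only: Pe)
    then show "x = y" by (simp add: x y)
  qed

  from one_two two_three three_one two_inj show ?thesis by blast
qed

end
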